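(* If $G$ is a graph that does not contain a universal vertex, then $c_{\min}(G) \ge 3$ if and only if for every vertex $v \in V(G)$, the closed neighborhood $N[v]$ is a dominating set of $G$.
   Context: Graphs are finite, simple and undirected, with nonempty vertex set. $N[v]$ is the closed neighborhood of $v$, i.e., $v$ together with all its neighbors. A vertex $v$ is universal if $N[v]=V(G)$. A set $S\subseteq V(G)$ is a dominating set of $G$ if every vertex of $V(G)\setminus S$ is adjacent to a vertex of $S$. All parts of a partition are nonempty. Two disjoint sets $X,Y\subseteq V(G)$ form a coalition in $G$ if neither $X$ nor $Y$ is a dominating set of $G$ but $X\cup Y$ is a dominating set of $G$. A $c$-partition of $G$ is a partition $\{V_1,\ldots,V_k\}$ of $V(G)$ such that each $V_i$ either is a dominating set consisting of a single vertex, or forms a coalition with some other set $V_j$ ($j\neq i$) of the partition. For partitions $\mathcal{A},\mathcal{B}$ of $V(G)$, $\mathcal{B}$ is a refinement of $\mathcal{A}$ if every set of $\mathcal{B}$ is equal to or a proper subset of some set of $\mathcal{A}$; it is a proper refinement if moreover $\mathcal{A}\ne\mathcal{B}$. A $c$-partition is minimal if it is not a proper refinement of any other $c$-partition of $G$. The minmin coalition number $c_{\min}(G)$ is the minimum number of sets in a minimal $c$-partition of $G$. *)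

theory Defs
  imports "Graph_Theory.Digraph" "HOL-Library.Disjoint_Sets"
begin

text \<open>
  Simple undirected graphs are the loop-free symmetric digraphs without parallel arcs of the
  locale \<^locale>\<open>graph\<close>, which includes finiteness but allows the empty vertex set. Adjacency of
  \<open>u\<close> and \<open>v\<close> is \<open>u \<rightarrow>\<^bsub>G\<^esub> v\<close>.
\<close>

definition closed_neighborhood :: "('a, 'b) pre_digraph \<Rightarrow> 'a \<Rightarrow> 'a set" where
  "closed_neighborhood G v = insert v {u. v \<rightarrow>\<^bsub>G\<^esub> u}"

definition universal_vertex :: "('a, 'b) pre_digraph \<Rightarrow> 'a \<Rightarrow> bool" where
  "universal_vertex G v \<longleftrightarrow> v \<in> verts G \<and> closed_neighborhood G v = verts G"

definition dominating_set :: "('a, 'b) pre_digraph \<Rightarrow> 'a set \<Rightarrow> bool" where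
  "dominating_set G S \<longleftrightarrow> S \<subseteq> verts G \<and> (\<forall>v \<in> verts G - S. \<exists>s \<in> S. v \<rightarrow>\<^bsub>G\<^esub> s)"

definition coalition :: "('a, 'b) pre_digraph \<Rightarrow> 'a set \<Rightarrow> 'a set \<Rightarrow> bool" where
  "coalition G X Y \<longleftrightarrow>
     X \<subseteq> verts G \<and> Y \<subseteq> verts G \<and> X \<inter> Y = {} \<and>
     \<not> dominating_set G X \<and> \<not> dominating_set G Y \<and> dominating_set G (X \<union> Y)"

definition c_partition :: "('a, 'b) pre_digraph \<Rightarrow> 'a set set \<Rightarrow> bool" where
  "c_partition G P \<longleftrightarrow>
     partition_on (verts G) P \<and>
     (\<forall>X \<in> P. (dominating_set G X \<and> is_singleton X) \<or> (\<exists>Y \<in> P. Y \<noteq> X \<and> coalition G X Y))"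

definition minimal_c_partition :: "('a, 'b) pre_digraph \<Rightarrow> 'a set set \<Rightarrow> bool" where
  "minimal_c_partition G P \<longleftrightarrow>
     c_partition G P \<and> \<not> (\<exists>Q. c_partition G Q \<and> refines (verts G) P Q \<and> Q \<noteq> P)"

text \<open>
  Every finite graph with nonempty vertex set has a \<open>c\<close>-partition, hence a minimal one, so the
  minimum below is attained for the graphs of interest.
\<close>

definition c_min :: "('a, 'b) pre_digraph \<Rightarrow> nat" where
  "c_min G = (LEAST k. \<exists>P. minimal_c_partition G P \<and> card P = k)"

end

theory Submission
  imports Defs
begin

text \<open>
  A set fails to dominate exactly when it misses some closed neighborhood. So if a set and its
  complement both fail to dominate, the set includes a whole closed neighborhood \<open>N[u]\<close> and misses
  another one, whence \<open>N[u]\<close> is not dominating; conversely a non-dominating \<open>N[u]\<close> and its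
  complement are two such sets. Without a universal vertex no singleton dominates, so the
  two-element \<open>c\<close>-partitions are exactly the splittings of the vertex set into two non-dominating
  parts, and there is no \<open>c\<close>-partition with fewer than two sets. Hence the neighborhood condition
  says that every \<open>c\<close>-partition has at least three sets.

  To pass from all \<open>c\<close>-partitions to the minimal ones, note that a proper refinement has more sets
  (\<open>card_less_if_proper_refines\<close>), so a \<open>c\<close>-partition with the fewest sets is minimal. Such a
  partition exists as soon as there is any \<open>c\<close>-partition at all, which is the content of
  \<open>c_partition_exists\<close>: take a maximal non-dominating set together with the singletons outside it.
\<close>

text \<open>
  Choosing in each part of the coarser partition a part of the finer one gives an injection; if it
  were onto, every coarse part would include only one fine part and so be equal to it.
\<close>

lemma card_less_if_proper_refines:
  assumes fin: "finite A" and ref: "refines A P Q" and ne: "Q \<noteq> P"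
  shows "card Q < card P"
proof -
  have P: "partition_on A P" and Q: "partition_on A Q"
    using ref by (auto simp: refines_def)
  have disj: "q = q'" if "q \<in> Q" "q' \<in> Q" "x \<in> q" "x \<in> q'" for q q' x
    using that partition_onD2[OF Q] by (auto simp: disjoint_def)
  have finP: "finite P" using finite_elements[OF fin P] .
  have "\<exists>p\<in>P. p \<subseteq> q" if "q \<in> Q" for q
  proof -
    have "q = \<Union> {p \<in> P. p \<subseteq> q}"
      using partition_onD1[OF refines_obtains_subset[OF ref that]] .
    moreover have "q \<noteq> {}" using partition_onD3[OF Q] that by blast
    ultimately show ?thesis by blast
  qed
  then obtain f where f: "\<And>q. q \<in> Q \<Longrightarrow> f q \<in> P \<and> f q \<subseteq> q" by metis
  have "inj_on f Q"
  proof (rule inj_onI)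
    fix q q' assume q: "q \<in> Q" "q' \<in> Q" "f q = f q'"
    then obtain x where "x \<in> f q" using f partition_onD3[OF P] by (metis ex_in_conv)
    then show "q = q'" using q f disj by (metis subsetD)
  qed
  then have card_image: "card (f ` Q) = card Q" by (rule card_image)
  have sub: "f ` Q \<subseteq> P" using f by auto
  have "f ` Q \<noteq> P"
  proof
    assume onto: "f ` Q = P"
    have "q \<subseteq> f q" if "q \<in> Q" for q
    proof
      fix x assume x: "x \<in> q"
      then have "x \<in> \<Union>P" using that partition_onD1[OF P] partition_onD1[OF Q] by blast
      then obtain p where "p \<in> P" "x \<in> p" by blast
      then obtain q' where "q' \<in> Q" "p = f q'" using onto by auto
      then have "q' = q" using disj f x that \<open>x \<in> p\<close> by blast
      then show "x \<in> f q" using \<open>x \<in> p\<close> \<open>p = f q'\<close> by simp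
    qed
    then have "refines A Q P" using P Q f unfolding refines_def by blast
    then show False using refines_asym ref ne by blast
  qed
  then have "card (f ` Q) < card P" using sub finP by (intro psubset_card_mono) auto
  then show ?thesis using card_image by simp
qed

lemma not_dominating_set_iff:
  assumes "S \<subseteq> verts G"
  shows "\<not> dominating_set G S \<longleftrightarrow> (\<exists>v\<in>verts G. closed_neighborhood G v \<inter> S = {})"
  using assms unfolding dominating_set_def closed_neighborhood_def by blast

lemma dominating_set_verts: "dominating_set G (verts G)"
  by (simp add: dominating_set_def)

context graph
begin

lemma closed_neighborhood_subset_verts:
  "v \<in> verts G \<Longrightarrow> closed_neighborhood G v \<subseteq> verts G"
  by (auto simp: closed_neighborhood_def dest: adj_in_verts)

lemma not_dominating_singleton:
  assumes no_univ: "\<not> universal_vertex G x" and x: "x \<in> verts G"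
  shows "\<not> dominating_set G {x}"
proof
  assume dom: "dominating_set G {x}"
  have "v \<in> closed_neighborhood G x" if "v \<in> verts G" for v
    using dom that arcs_ends_symmetric[OF sym_arcs]
    by (auto simp: dominating_set_def closed_neighborhood_def)
  then show False
    using no_univ x closed_neighborhood_subset_verts[OF x] by (auto simp: universal_vertex_def)
qed

text \<open>
  A maximal non-dominating set \<open>M\<close> becomes dominating as soon as any further vertex is added, so
  \<open>M\<close> forms a coalition with each singleton outside it. Starting the maximization from a singleton
  makes \<open>M\<close> nonempty, and \<open>M\<close> is proper since the whole vertex set dominates.
\<close>

lemma c_partition_exists:
  assumes ne: "verts G \<noteq> {}" and no_univ: "\<not> (\<exists>v. universal_vertex G v)"
  shows "\<exists>P. c_partition G P"
proof -
  have single: "\<not> dominating_set G {x}" if "x \<in> verts G" for x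
    using that no_univ not_dominating_singleton by blast
  obtain v where v: "v \<in> verts G" using ne by auto
  define F where "F = {S. S \<subseteq> verts G \<and> \<not> dominating_set G S}"
  have "finite F" unfolding F_def by (rule finite_subset[of _ "Pow (verts G)"]) auto
  moreover have "{v} \<in> F" using v single by (simp add: F_def)
  ultimately obtain M where M: "M \<in> F" "{v} \<subseteq> M" and max: "\<forall>S\<in>F. M \<subseteq> S \<longrightarrow> M = S"
    using finite_has_maximal2[of F "{v}"] by blast
  have M_sub: "M \<subseteq> verts G" and M_nd: "\<not> dominating_set G M" using M by (auto simp: F_def)
  have co: "coalition G M {x}" "coalition G {x} M" if "x \<in> verts G - M" for x
  proof -
    have "M \<union> {x} \<notin> F" using max that by blast
    then have "dominating_set G (M \<union> {x})" using that M_sub by (auto simp: F_def)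
    then show "coalition G M {x}" "coalition G {x} M"
      using that M_sub M_nd single by (auto simp: coalition_def Un_commute)
  qed
  let ?P = "insert M ((\<lambda>x. {x}) ` (verts G - M))"
  have "partition_on (verts G) ?P"
    using M M_sub by (auto simp: partition_on_def disjoint_def)
  moreover have "\<exists>Y\<in>?P. Y \<noteq> X \<and> coalition G X Y" if "X \<in> ?P" for X
  proof (cases "X = M")
    case True
    have "M \<noteq> verts G" using M_nd dominating_set_verts[of G] by auto
    then obtain x where "x \<in> verts G - M" using M_sub by blast
    then show ?thesis using co True by blast
  next
    case False
    then show ?thesis using that co by blast
  qed
  ultimately show ?thesis unfolding c_partition_def by blast
qed

lemma card_c_partition_ge_2:
  assumes ne: "verts G \<noteq> {}" and no_univ: "\<not> (\<exists>v. universal_vertex G v)"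
    and P: "c_partition G P"
  shows "2 \<le> card P"
proof -
  have part: "partition_on (verts G) P" using P by (simp add: c_partition_def)
  then obtain X where X: "X \<in> P" using ne by (auto simp: partition_on_def)
  have X_sub: "X \<subseteq> verts G" using partition_onD1[OF part] X by auto
  then have "\<not> (dominating_set G X \<and> is_singleton X)"
    using not_dominating_singleton no_univ by (auto simp: is_singleton_def)
  then obtain Y where Y: "Y \<in> P" "Y \<noteq> X" using P X by (auto simp: c_partition_def)
  have "finite P" using finite_elements[OF finite_verts part] .
  then have "card {X, Y} \<le> card P" using X Y by (intro card_mono) auto
  then show ?thesis using Y by simp
qed

text \<open>
  Coarsening properly lowers the number of sets, so a \<open>c\<close>-partition with the fewest sets is minimal.
  The minimum over the minimal \<open>c\<close>-partitions is therefore the minimum over all of them, and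
  minimality need not be considered again. The existence hypothesis guards against the arbitrary
  value of \<open>LEAST\<close> on an unsatisfiable predicate.
\<close>

lemma c_min_is_minimum:
  assumes P: "c_partition G P"
  shows "c_min G \<le> card P" and "\<exists>Q. c_partition G Q \<and> card Q = c_min G"
proof -
  obtain R where R: "c_partition G R" and least: "\<And>S. c_partition G S \<Longrightarrow> card R \<le> card S"
    using ex_has_least_nat[of "c_partition G" P card] P by blast
  have minimal: "minimal_c_partition G R"
    using R least card_less_if_proper_refines[OF finite_verts]
    unfolding minimal_c_partition_def by (meson leD)
  then have "c_min G \<le> card R" unfolding c_min_def by (blast intro: Least_le)
  also have "\<dots> \<le> card P" using least P .
  finally show "c_min G \<le> card P" .
  have "\<exists>k S. minimal_c_partition G S \<and> card S = k" using minimal by blast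
  from LeastI_ex[OF this] show "\<exists>Q. c_partition G Q \<and> card Q = c_min G"
    unfolding c_min_def minimal_c_partition_def by blast
qed

text \<open>
  If neither \<open>X\<close> nor its complement \<open>Y\<close> dominates, then \<open>Y\<close> misses some \<open>N[u]\<close>, so \<open>N[u]\<close> lies in \<open>X\<close>,
  and \<open>X\<close> misses some \<open>N[v]\<close>. Thus \<open>N[u]\<close> and \<open>N[v]\<close> are disjoint, and \<open>N[u]\<close> leaves \<open>v\<close> undominated.
  In the other direction \<open>N[u]\<close> itself serves as \<open>X\<close>.
\<close>

lemma c_partition_of_card_2_iff:
  assumes no_univ: "\<not> (\<exists>v. universal_vertex G v)"
  shows "(\<exists>P. c_partition G P \<and> card P = 2) \<longleftrightarrow>
    (\<exists>u\<in>verts G. \<not> dominating_set G (closed_neighborhood G u))"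
proof
  assume "\<exists>P. c_partition G P \<and> card P = 2"
  then obtain P where P: "c_partition G P" and "card P = 2" by blast
  then obtain X Y where XY: "P = {X, Y}" "X \<noteq> Y" by (auto simp: card_2_iff)
  have part: "partition_on (verts G) {X, Y}" using P XY by (simp add: c_partition_def)
  have X_sub: "X \<subseteq> verts G" using partition_onD1[OF part] by auto
  then have "\<not> (dominating_set G X \<and> is_singleton X)"
    using not_dominating_singleton no_univ by (auto simp: is_singleton_def)
  then have "coalition G X Y" using P XY by (auto simp: c_partition_def)
  then have "Y \<subseteq> verts G" "\<not> dominating_set G X" "\<not> dominating_set G Y"
    by (auto simp: coalition_def)
  then obtain u v where uv: "u \<in> verts G" "v \<in> verts G"
    "closed_neighborhood G u \<inter> Y = {}" "closed_neighborhood G v \<inter> X = {}"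
    using X_sub not_dominating_set_iff by metis
  have "closed_neighborhood G u \<subseteq> X"
    using uv partition_onD1[OF part] closed_neighborhood_subset_verts[OF uv(1)] by auto
  then have "closed_neighborhood G v \<inter> closed_neighborhood G u = {}" using uv by auto
  then show "\<exists>u\<in>verts G. \<not> dominating_set G (closed_neighborhood G u)"
    using uv closed_neighborhood_subset_verts not_dominating_set_iff by metis
next
  assume "\<exists>u\<in>verts G. \<not> dominating_set G (closed_neighborhood G u)"
  then obtain u where u: "u \<in> verts G" and nd: "\<not> dominating_set G (closed_neighborhood G u)"
    by blast
  define A where "A = closed_neighborhood G u"
  define B where "B = verts G - A"
  have A_sub: "A \<subseteq> verts G" unfolding A_def by (rule closed_neighborhood_subset_verts[OF u])
  have A_nd: "\<not> dominating_set G A" using nd by (simp add: A_def)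
  \<comment> \<open>By construction \<open>B\<close> misses the closed neighborhood of \<open>u\<close>, so it leaves \<open>u\<close> undominated.\<close>
  have "\<not> dominating_set G B"
    using u not_dominating_set_iff[of B G] by (auto simp: A_def B_def)
  then have co: "coalition G A B" "coalition G B A"
    using A_sub A_nd dominating_set_verts[of G]
    by (auto simp: coalition_def B_def Un_absorb1 Un_commute)
  have "A \<noteq> {}" by (simp add: A_def closed_neighborhood_def)
  moreover have "B \<noteq> {}" using A_sub A_nd dominating_set_verts[of G] by (auto simp: B_def)
  moreover have "A \<noteq> B" using \<open>A \<noteq> {}\<close> by (auto simp: B_def)
  ultimately have "partition_on (verts G) {A, B}"
    using A_sub by (auto simp: partition_on_def disjoint_def B_def)
  then have "c_partition G {A, B}" using co \<open>A \<noteq> B\<close> by (auto simp: c_partition_def)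
  then show "\<exists>P. c_partition G P \<and> card P = 2" using \<open>A \<noteq> B\<close> by (metis card_2_iff)
qed

end

theorem theorem3:
  fixes G :: "('a, 'b) pre_digraph"
  assumes "graph G"
    and "verts G \<noteq> {}"
    and "\<not> (\<exists>v. universal_vertex G v)"
  shows "c_min G \<ge> 3 \<longleftrightarrow> (\<forall>v \<in> verts G. dominating_set G (closed_neighborhood G v))"
proof -
  interpret graph G by fact
  obtain Q where Q: "c_partition G Q" "card Q = c_min G"
    using c_partition_exists[OF assms(2,3)] c_min_is_minimum(2) by blast
  have "2 \<le> c_min G" using card_c_partition_ge_2[OF assms(2,3) Q(1)] Q(2) by simp
  then have "c_min G \<ge> 3 \<longleftrightarrow> \<not> (\<exists>P. c_partition G P \<and> card P = 2)"
    using Q c_min_is_minimum(1) by fastforce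
  then show ?thesis using c_partition_of_card_2_iff[OF assms(3)] by blast
qed

end
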